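(* For any field $F$ of characteristic $0$ and any $n\ge 2$, the monoid $U^{\pm}T_n(F)$ is nonfinitely based.
   Context: An $n\times n$ matrix $(\alpha_{ij})$ is triangular if $\alpha_{ij}=0$ whenever $j<i$. For a field $F$ of characteristic different from $2$, $U^{\pm}T_n(F)$ is the monoid, under matrix multiplication, of all triangular $n\times n$ matrices over $F$ whose diagonal entries all lie in $\{0,1,-1\}$. Monoids are considered as semigroups, i.e., in the signature with only the binary multiplication. Let $\mathcal{X}^+$ be the free semigroup on a countably infinite set $\mathcal{X}$ of variables. A semigroup identity is a pair $\mathbf{u}\approx\mathbf{v}$ of words in $\mathcal{X}^+$; it holds in a semigroup $S$ if $\varphi(\mathbf{u})=\varphi(\mathbf{v})$ for every morphism $\varphi:\mathcal{X}^+\to S$. An identity is a consequence of a set $\Sigma$ of identities if it holds in every semigroup satisfying all identities in $\Sigma$. A semigroup $S$ is finitely based if there is a finite set $\Sigma$ of identities holding in $S$ such that every identity holding in $S$ is a consequence of $\Sigma$; otherwise $S$ is nonfinitely based. *)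

theory Defs
  imports
    "Jordan_Normal_Form.Matrix"
    "HOL-Algebra.Group"
    "HOL-Library.Countable_Set"
begin

text \<open>
  Semigroups are rendered as HOL-Algebra records of which only \<open>carrier\<close> and \<open>mult\<close> are
  used; the field \<open>one\<close> is ignored. This is compatible with \<open>hom\<close>, which imposes no
  condition on \<open>one\<close>, and lets a monoid be regarded as a semigroup without conversion.
\<close>

definition is_semigroup :: "('a, 'b) monoid_scheme \<Rightarrow> bool" where
  "is_semigroup S \<longleftrightarrow>
     (\<forall>x\<in>carrier S. \<forall>y\<in>carrier S. x \<otimes>\<^bsub>S\<^esub> y \<in> carrier S) \<and>
     (\<forall>x\<in>carrier S. \<forall>y\<in>carrier S. \<forall>z\<in>carrier S.
        (x \<otimes>\<^bsub>S\<^esub> y) \<otimes>\<^bsub>S\<^esub> z = x \<otimes>\<^bsub>S\<^esub> (y \<otimes>\<^bsub>S\<^esub> z))"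

text \<open>
  The countably infinite set of variables is the type \<open>nat\<close>. The empty word is excluded from
  the carrier (the value of \<open>one\<close> is irrelevant).
\<close>

definition free_semigroup :: "nat list monoid" where
  "free_semigroup = \<lparr>carrier = {w. w \<noteq> []}, monoid.mult = (@), one = []\<rparr>"

type_synonym identity = "nat list \<times> nat list"

definition semigroup_identities :: "identity set" where
  "semigroup_identities = carrier free_semigroup \<times> carrier free_semigroup"

definition holds_in :: "('a, 'b) monoid_scheme \<Rightarrow> identity \<Rightarrow> bool" where
  "holds_in S e \<longleftrightarrow> (\<forall>\<phi>\<in>hom free_semigroup S. \<phi> (fst e) = \<phi> (snd e))"

text \<open>
  A HOL formula cannot quantify over types, so the semigroups tested here have as carrier an
  arbitrary (finite or infinite) set of natural numbers. Nothing is lost: by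
  \<open>consequence_holds_in\<close> below, a consequence in this sense holds in every semigroup, over
  any type, that satisfies all identities of \<open>\<Sigma>\<close>.
\<close>

definition consequence :: "identity set \<Rightarrow> identity \<Rightarrow> bool" where
  "consequence \<Sigma> e \<longleftrightarrow>
     (\<forall>T :: nat monoid. is_semigroup T \<and> (\<forall>p\<in>\<Sigma>. holds_in T p) \<longrightarrow> holds_in T e)"

definition finitely_based :: "('a, 'b) monoid_scheme \<Rightarrow> bool" where
  "finitely_based S \<longleftrightarrow>
     (\<exists>\<Sigma>. finite \<Sigma> \<and> \<Sigma> \<subseteq> semigroup_identities \<and> (\<forall>p\<in>\<Sigma>. holds_in S p) \<and>
        (\<forall>e\<in>semigroup_identities. holds_in S e \<longrightarrow> consequence \<Sigma> e))"

abbreviation nonfinitely_based :: "('a, 'b) monoid_scheme \<Rightarrow> bool" where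
  "nonfinitely_based S \<equiv> \<not> finitely_based S"

definition UpmT :: "nat \<Rightarrow> 'a::field mat monoid" where
  "UpmT n =
     \<lparr>carrier = {A \<in> carrier_mat n n. upper_triangular A \<and> (\<forall>i<n. A $$ (i, i) \<in> {0, 1, -1})},
      monoid.mult = (*), one = 1\<^sub>m n\<rparr>"

lemma consequence_holds_in:
  fixes S :: "('a, 'b) monoid_scheme"
  assumes S: "is_semigroup S"
    and \<Sigma>: "\<Sigma> \<subseteq> semigroup_identities" "\<And>p. p \<in> \<Sigma> \<Longrightarrow> holds_in S p"
    and e: "e \<in> semigroup_identities" "consequence \<Sigma> e"
  shows "holds_in S e"
  unfolding holds_in_def
proof
  fix \<phi> assume \<phi>: "\<phi> \<in> hom free_semigroup S"
  define C where "C = \<phi> ` {w. w \<noteq> []}"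
  define f where "f = to_nat_on C"
  define g where "g = inv_into C f"
  define T :: "nat monoid"
    where "T = \<lparr>carrier = f ` C, monoid.mult = (\<lambda>x y. f (g x \<otimes>\<^bsub>S\<^esub> g y)), one = 0\<rparr>"
  have inj: "inj_on f C"
    unfolding f_def C_def by (rule inj_on_to_nat_on) simp
  have gf [simp]: "g (f x) = x" if "x \<in> C" for x
    unfolding g_def using inj that by (rule inv_into_f_f)
  have \<phi>S: "\<phi> w \<in> carrier S" if "w \<noteq> []" for w
    using \<phi> that by (auto simp: hom_def free_semigroup_def)
  have \<phi>m: "\<phi> (v @ w) = \<phi> v \<otimes>\<^bsub>S\<^esub> \<phi> w" if "v \<noteq> []" "w \<noteq> []" for v w
    using \<phi> that by (auto simp: hom_def free_semigroup_def)
  have CS: "x \<in> carrier S" if "x \<in> C" for x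
    using that \<phi>S by (auto simp: C_def)
  have CC: "x \<otimes>\<^bsub>S\<^esub> y \<in> C" if x: "x \<in> C" and y: "y \<in> C" for x y
  proof -
    from x y obtain v w where "x = \<phi> v" "v \<noteq> []" "y = \<phi> w" "w \<noteq> []"
      by (auto simp: C_def)
    then have "x \<otimes>\<^bsub>S\<^esub> y = \<phi> (v @ w)" "v @ w \<noteq> []" by (simp_all add: \<phi>m)
    then show ?thesis unfolding C_def by blast
  qed
  have T: "is_semigroup T"
    using S CS CC by (auto simp: is_semigroup_def T_def)
  have "holds_in T p" if p: "p \<in> \<Sigma>" for p
    unfolding holds_in_def
  proof
    fix \<psi> assume \<psi>: "\<psi> \<in> hom free_semigroup T"
    have p': "fst p \<noteq> []" "snd p \<noteq> []"
      using p \<Sigma>(1) by (auto simp: semigroup_identities_def free_semigroup_def)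
    have \<psi>T: "\<psi> w \<in> f ` C" if "w \<noteq> []" for w
      using \<psi> that by (auto simp: hom_def free_semigroup_def T_def)
    have gC: "g (\<psi> w) \<in> C" if "w \<noteq> []" for w
      using \<psi>T[OF that] by auto
    have \<psi>m: "\<psi> (v @ w) = f (g (\<psi> v) \<otimes>\<^bsub>S\<^esub> g (\<psi> w))" if "v \<noteq> []" "w \<noteq> []" for v w
      using \<psi> that by (auto simp: hom_def free_semigroup_def T_def)
    have "(\<lambda>w. g (\<psi> w)) \<in> hom free_semigroup S"
      using gC CS by (auto simp: hom_def free_semigroup_def \<psi>m CC)
    from bspec[OF \<Sigma>(2)[OF p, unfolded holds_in_def] this]
    have "g (\<psi> (fst p)) = g (\<psi> (snd p))" .
    then show "\<psi> (fst p) = \<psi> (snd p)"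
      using \<psi>T[OF p'(1)] \<psi>T[OF p'(2)] by auto
  qed
  with e(2) T have "holds_in T e" unfolding consequence_def by blast
  then have "\<forall>\<psi>\<in>hom free_semigroup T. \<psi> (fst e) = \<psi> (snd e)"
    unfolding holds_in_def .
  moreover have "(\<lambda>w. f (\<phi> w)) \<in> hom free_semigroup T"
    by (auto simp: hom_def free_semigroup_def T_def C_def \<phi>m gf[unfolded C_def])
  ultimately have "f (\<phi> (fst e)) = f (\<phi> (snd e))"
    by (rule bspec)
  moreover have "\<phi> (fst e) \<in> C" "\<phi> (snd e) \<in> C"
    using e(1) by (auto simp: semigroup_identities_def free_semigroup_def C_def)
  ultimately show "\<phi> (fst e) = \<phi> (snd e)"
    using inj by (simp add: inj_on_eq_iff)
qed

lemma upper_triangular_mult_diag: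
  fixes A B :: "'a::semiring_1 mat"
  assumes A: "A \<in> carrier_mat n n" "upper_triangular A"
    and B: "B \<in> carrier_mat n n" "upper_triangular B"
  shows "upper_triangular (A * B)"
    and "i < n \<Longrightarrow> (A * B) $$ (i, i) = A $$ (i, i) * B $$ (i, i)"
proof -
  have entry: "(A * B) $$ (i, j) = (\<Sum>k<n. A $$ (i, k) * B $$ (k, j))" if "i < n" "j < n" for i j
    using A B that by (auto simp: scalar_prod_def lessThan_atLeast0 intro!: sum.cong)
  show "upper_triangular (A * B)"
  proof
    fix i j assume ij: "j < i" "i < dim_row (A * B)"
    then have n: "i < n" "j < n" using A by auto
    have "A $$ (i, k) * B $$ (k, j) = 0" if "k < n" for k
      using that ij n A B by (cases "k < i") (auto simp: upper_triangular_def)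
    then show "(A * B) $$ (i, j) = 0" by (simp add: entry n)
  qed
  assume i: "i < n"
  have "A $$ (i, k) * B $$ (k, i) = (if k = i then A $$ (i, i) * B $$ (i, i) else 0)"
    if "k < n" for k
    using that i A B by (cases k i rule: linorder_cases) (auto simp: upper_triangular_def)
  then have "(A * B) $$ (i, i) = (\<Sum>k<n. if k = i then A $$ (i, i) * B $$ (i, i) else 0)"
    unfolding entry[OF i i] by (intro sum.cong) auto
  then show "(A * B) $$ (i, i) = A $$ (i, i) * B $$ (i, i)"
    using i by simp
qed

lemma monoid_UpmT: "monoid (UpmT n :: 'a::field mat monoid)"
proof (rule monoidI)
  fix A B :: "'a mat"
  assume "A \<in> carrier (UpmT n)" "B \<in> carrier (UpmT n)"
  then have A: "A \<in> carrier_mat n n" "upper_triangular A" "\<And>i. i < n \<Longrightarrow> A $$ (i, i) \<in> {0, 1, -1}"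
    and B: "B \<in> carrier_mat n n" "upper_triangular B" "\<And>i. i < n \<Longrightarrow> B $$ (i, i) \<in> {0, 1, -1}"
    by (auto simp: UpmT_def)
  have "(A * B) $$ (i, i) \<in> {0, 1, -1}" if "i < n" for i
    using A(3)[OF that] B(3)[OF that]
    unfolding upper_triangular_mult_diag(2)[OF A(1,2) B(1,2) that] by auto
  then show "A \<otimes>\<^bsub>UpmT n\<^esub> B \<in> carrier (UpmT n)"
    using A B upper_triangular_mult_diag(1)[OF A(1,2) B(1,2)] by (simp add: UpmT_def)
qed (auto simp: UpmT_def)

lemma is_semigroup_UpmT: "is_semigroup (UpmT n :: 'a::field mat monoid)"
proof -
  interpret monoid "UpmT n :: 'a mat monoid" by (rule monoid_UpmT)
  show ?thesis by (simp add: is_semigroup_def m_assoc)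
qed

end

theory Submission
  imports Defs "HOL-Library.Sublist"
begin

text \<open>
  Call a word even if every letter occurs in it an even number of times. Along a word without
  nonempty even factors all prefixes have distinct parity vectors, and averaging over sign
  characters shows that such a word is an isoterm for \<open>UpmT n\<close>, \<open>n \<ge> 2\<close>. So in a nontrivial
  identity both sides contain an even factor. Given a finite set of identities, the even factors of
  their sides form a finite set of patterns in which every variable occurs at least twice, and
  over a large alphabet there are at least \<open>2 ^ l\<close> words of length \<open>l\<close> avoiding these patterns; no
  identity of the set applies to them nontrivially. On the other hand, expanding a product of
  triangular matrices along paths shows that words of length \<open>l\<close> over a fixed finite alphabet
  induce only polynomially many functions on \<open>UpmT n\<close>, so two avoiding words form an identity of
  \<open>UpmT n\<close>.
\<close>

section \<open>Words avoiding patterns\<close>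

definition subst :: "('b \<Rightarrow> 'c list) \<Rightarrow> 'b list \<Rightarrow> 'c list" where
  "subst f e = concat (map f e)"

text \<open>Pattern containment in the usual sense of combinatorics on words, under nonerasing
  substitutions.\<close>

definition encounters :: "'c list \<Rightarrow> 'b list \<Rightarrow> bool" where
  "encounters w e \<longleftrightarrow> (\<exists>f. (\<forall>x\<in>set e. f x \<noteq> []) \<and> sublist (subst f e) w)"

definition avoiding :: "'c set \<Rightarrow> 'b list set \<Rightarrow> nat \<Rightarrow> 'c list set" where
  "avoiding A P l = {w. length w = l \<and> set w \<subseteq> A \<and> (\<forall>e\<in>P. \<not> encounters w e)}"

lemma finite_avoiding: "finite A \<Longrightarrow> finite (avoiding A P l)"
  by (rule finite_subset[OF _ finite_lists_length_eq[of A l]]) (auto simp: avoiding_def)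

lemma subst_restrict: "subst (restrict f (set e)) e = subst f e"
  unfolding subst_def by (intro arg_cong[of _ _ concat] map_cong) auto

lemma length_subst: "length (subst f e) = (\<Sum>x\<in>set e. count_list e x * length (f x))"
  unfolding subst_def length_concat map_map o_def
  using sum_list_map_eq_sum_count[of "\<lambda>x. length (f x)" e] by simp

lemma encounters_mono: "encounters v e \<Longrightarrow> sublist v w \<Longrightarrow> encounters w e"
  unfolding encounters_def by (meson sublist_order.order_trans)

section \<open>Exponential lower bound on the number of avoiding words\<close>

text \<open>The sum factors into one sum per variable of \<open>e\<close>. As each variable occurs
  at least twice, its factor is dominated by a geometric series with ratio m / \<mu>^2 = 4 / m,
  whose full sum is 4 / (m - 4).\<close>

lemma weighted_substitutions_le:
  fixes m N :: nat and \<mu> :: real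
  assumes A: "finite A" "card A = m" and m: "m > 4"
    and e: "e \<noteq> []" "\<And>x. x \<in> set e \<Longrightarrow> count_list e x \<ge> 2" and \<mu>: "\<mu> = m / 2"
    and W: "W = {w. set w \<subseteq> A \<and> 1 \<le> length w \<and> length w \<le> N}"
    and q: "4 / (m - 4) \<le> q" "q \<le> 1"
  shows "(\<Sum>f\<in>PiE (set e) (\<lambda>_. W). (1 / \<mu>) ^ length (subst f e)) \<le> q"
proof -
  define r where "r = (1 / \<mu>)"
  have r: "0 < r" "r < 1" using m by (auto simp: r_def \<mu>)
  have finW: "finite W"
    unfolding W by (rule finite_subset[OF _ finite_lists_length_le[OF A(1), of N]]) auto
  have one: "(\<Sum>w\<in>W. (r\<^sup>2) ^ length w) \<le> q"
  proof -
    define z where "z = 4 / real m"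
    have z: "0 < z" "z < 1" using m by (auto simp: z_def)
    have W': "W = (\<Union>l\<in>{1..N}. {w. set w \<subseteq> A \<and> length w = l})"
      unfolding W by auto
    have "(\<Sum>w\<in>W. (r\<^sup>2) ^ length w)
        = (\<Sum>l\<in>{1..N}. \<Sum>w\<in>{w. set w \<subseteq> A \<and> length w = l}. (r\<^sup>2) ^ length w)"
      unfolding W' by (rule sum.UNION_disjoint) (auto simp: finite_lists_length_eq[OF A(1)])
    also have "\<dots> = (\<Sum>l\<in>{1..N}. z ^ l)"
    proof (rule sum.cong[OF refl])
      fix l
      have "(\<Sum>w\<in>{w. set w \<subseteq> A \<and> length w = l}. (r\<^sup>2) ^ length w) = real (m ^ l) * (r\<^sup>2) ^ l"
        using card_lists_length_eq[OF A(1), of l] A(2) by simp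
      also have "\<dots> = (m * r\<^sup>2) ^ l" by (simp add: power_mult_distrib)
      also have "m * r\<^sup>2 = z" using m by (simp add: r_def \<mu> z_def power2_eq_square field_simps)
      finally show "(\<Sum>w\<in>{w. set w \<subseteq> A \<and> length w = l}. (r\<^sup>2) ^ length w) = z ^ l" .
    qed
    also have "\<dots> = z * (1 - z ^ N) / (1 - z)"
      using z by (simp add: sum_gp power_Suc2 algebra_simps)
    also have "\<dots> \<le> z / (1 - z)"
      using z by (intro divide_right_mono) (auto simp: algebra_simps)
    also have "\<dots> = 4 / (m - 4)"
      using m by (simp add: z_def field_simps of_nat_diff)
    finally show ?thesis using q by simp
  qed
  have "(\<Sum>f\<in>PiE (set e) (\<lambda>_. W). r ^ length (subst f e))
      = (\<Sum>f\<in>PiE (set e) (\<lambda>_. W). \<Prod>x\<in>set e. r ^ (count_list e x * length (f x)))"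
    by (simp add: length_subst power_sum)
  also have "\<dots> = (\<Prod>x\<in>set e. \<Sum>w\<in>W. r ^ (count_list e x * length w))"
    by (subst prod_sum_PiE) (use finW in auto)
  also have "\<dots> \<le> (\<Prod>x\<in>set e. q)"
  proof (rule prod_mono, intro conjI)
    fix x assume x: "x \<in> set e"
    show "0 \<le> (\<Sum>w\<in>W. r ^ (count_list e x * length w))" using r by (intro sum_nonneg) auto
    have "(\<Sum>w\<in>W. r ^ (count_list e x * length w)) \<le> (\<Sum>w\<in>W. r ^ (2 * length w))"
      using r e(2)[OF x] by (intro sum_mono power_decreasing) auto
    also have "\<dots> \<le> q" using one by (simp add: power_mult)
    finally show "(\<Sum>w\<in>W. r ^ (count_list e x * length w)) \<le> q" .
  qed
  also have "\<dots> = q ^ card (set e)" by simp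
  \<comment> \<open>There is at least one variable and \<open>q\<close> is at most 1, so a single
    factor gives the bound.\<close>
  also have "\<dots> \<le> q ^ 1"
  proof (rule power_decreasing)
    show "1 \<le> card (set e)" using e(1) by (simp add: Suc_le_eq card_gt_0_iff)
    show "0 \<le> q" using q m by (meson order_trans divide_nonneg_nonneg of_nat_0_le_iff zero_le_numeral)
  qed (use q in auto)
  finally show ?thesis by (simp add: r_def)
qed

text \<open>An occurrence that is absent from \<open>w\<close> must use the last letter. Restricting
  \<open>f\<close> to the variables of \<open>e\<close> and bounding the lengths of its values makes
  it range over a finite set, as the counting requires.\<close>

lemma new_occurrence_is_suffix:
  assumes "encounters (w @ [a]) e" "\<not> encounters w e" "set (w @ [a]) \<subseteq> A" "e \<noteq> []"
  obtains f y where
    "f \<in> PiE (set e) (\<lambda>_. {v. set v \<subseteq> A \<and> 1 \<le> length v \<and> length v \<le> Suc (length w)})"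
    "w @ [a] = y @ subst f e" "subst f e \<noteq> []"
proof -
  obtain f where f: "\<forall>x\<in>set e. f x \<noteq> []" "sublist (subst f e) (w @ [a])"
    using assms(1) unfolding encounters_def by blast
  have nsub: "\<not> sublist (subst f e) w"
    using assms(2) f(1) unfolding encounters_def by blast
  obtain y z where yz: "w @ [a] = y @ subst f e @ z"
    using f(2) unfolding sublist_def by blast
  have z: "z = []"
  proof (rule ccontr)
    assume "z \<noteq> []"
    then have "w = y @ subst f e @ butlast z"
      using arg_cong[OF yz, of butlast] by (simp add: butlast_append)
    then show False using nsub unfolding sublist_def by blast
  qed
  have ne: "subst f e \<noteq> []"
    using f(1) assms(4) unfolding subst_def by (cases e) auto
  have fx: "set (f x) \<subseteq> A \<and> 1 \<le> length (f x) \<and> length (f x) \<le> Suc (length w)"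
    if x: "x \<in> set e" for x
  proof -
    have s: "sublist (f x) (subst f e)"
    proof -
      obtain ys zs where "e = ys @ x # zs" using split_list[OF x] by blast
      then have "subst f e = subst f ys @ f x @ subst f zs" by (simp add: subst_def)
      then show ?thesis by (metis sublist_appendI)
    qed
    have s': "sublist (f x) (w @ [a])" using s f(2) by (rule sublist_order.order_trans)
    have "set (f x) \<subseteq> A" using set_mono_sublist[OF s'] assms(3) by blast
    moreover have "length (f x) \<le> Suc (length w)" using sublist_length_le[OF s'] by simp
    ultimately show ?thesis using f(1) x by (auto simp: Suc_le_eq)
  qed
  show ?thesis
  proof (rule that[of "restrict f (set e)" y])
    show "restrict f (set e) \<in> PiE (set e)
        (\<lambda>_. {v. set v \<subseteq> A \<and> 1 \<le> length v \<and> length v \<le> Suc (length w)})"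
      using fx by auto
  qed (use yz z ne in \<open>auto simp: subst_restrict\<close>)
qed

text \<open>
  An extension of an avoiding word by one letter fails to avoid \<open>P\<close> only if it ends in a value of
  some pattern; as every variable is repeated, such a value of length \<open>l\<close> carries the information
  of at most \<open>l / 2\<close> letters.
\<close>

lemma card_avoiding_Suc:
  fixes A :: "'c set" and P :: "'b list set" and \<mu> :: real
  assumes A: "finite A" "card A = m" and P: "finite P" and m: "m = 4 * card P + 4"
    and pat: "\<And>e. e \<in> P \<Longrightarrow> e \<noteq> []" "\<And>e x. e \<in> P \<Longrightarrow> x \<in> set e \<Longrightarrow> count_list e x \<ge> 2"
    and \<mu>: "\<mu> = m / 2"
  shows "\<mu> * card (avoiding A P l) \<le> card (avoiding A P (Suc l))"
proof (induction l rule: less_induct)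
  case (less l)
  define g where "g k = real (card (avoiding A P k))" for k
  have lam: "\<mu> \<ge> 1" using m \<mu> by simp
  \<comment> \<open>The induction hypothesis iterated: shortening by \<open>d\<close> letters
    divides the number of avoiding words by at least \<mu>^d.\<close>
  have step: "\<mu> ^ d * g k \<le> g (k + d)" if "k + d \<le> l" for k d
    using that
  proof (induction d)
    case (Suc d)
    have "\<mu> ^ Suc d * g k = \<mu> * (\<mu> ^ d * g k)" by simp
    also have "\<dots> \<le> \<mu> * g (k + d)" using Suc lam by (intro mult_left_mono) auto
    also have "\<dots> \<le> g (k + Suc d)" using less.IH[of "k + d"] Suc.prems by (simp add: g_def)
    finally show ?case .
  qed simp
  define W where "W = {v. set v \<subseteq> A \<and> 1 \<le> length v \<and> length v \<le> Suc l}"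
  have finW: "finite W"
    unfolding W_def by (rule finite_subset[OF _ finite_lists_length_le[OF A(1), of "Suc l"]]) auto
  define F where "F e = PiE (set e) (\<lambda>_. W)" for e :: "'b list"
  have finF: "finite (F e)" for e unfolding F_def using finW by (intro finite_PiE) auto
  \<comment> \<open>\<open>X\<close> collects all one-letter extensions of avoiding words;
    \<open>Y e f\<close> collects the words consisting of an avoiding word followed by the value of
    \<open>e\<close> under \<open>f\<close>.\<close>
  define X where "X = (\<lambda>(w, a). w @ [a]) ` (avoiding A P l \<times> A)"
  define Y where "Y e f = (if subst f e \<noteq> [] \<and> length (subst f e) \<le> Suc l
     then (\<lambda>y. y @ subst f e) ` avoiding A P (Suc l - length (subst f e)) else {})"
    for e and f :: "'b \<Rightarrow> 'c list"
  have cardX: "real (card X) = m * g l"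
    unfolding X_def g_def
    by (subst card_image) (auto simp: inj_on_def card_cartesian_product A)
  have finY: "finite (Y e f)" for e f
    unfolding Y_def using finite_avoiding[OF A(1)] by auto
  have finav: "finite (avoiding A P k)" for k by (rule finite_avoiding[OF A(1)])
  \<comment> \<open>A suffix of length d + 1 leaves an avoiding word of length l - d, so
    \<open>step\<close> applies; the surplus letter accounts for the extra factor \<mu>.\<close>
  have cardY: "real (card (Y e f)) \<le> \<mu> * g l * (1 / \<mu>) ^ length (subst f e)" for e f
  proof (cases "subst f e \<noteq> [] \<and> length (subst f e) \<le> Suc l")
    case True
    define d where "d = length (subst f e) - 1"
    have d: "length (subst f e) = Suc d" "d \<le> l"
      using True by (auto simp: d_def Suc_le_eq)
    have "real (card (Y e f)) \<le> g (l - d)"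
      using True d unfolding Y_def g_def by (auto intro!: card_image_le finav)
    also have "\<dots> \<le> g l * (1 / \<mu>) ^ d"
      using step[of "l - d" d] d lam by (simp add: field_simps power_divide)
    also have "\<dots> = \<mu> * g l * (1 / \<mu>) ^ length (subst f e)"
      using lam by (simp add: d)
    finally show ?thesis .
  next
    case False
    then have "Y e f = {}" by (auto simp: Y_def)
    then show ?thesis using lam by (simp add: g_def)
  qed
  \<comment> \<open>If an extension of \<open>w\<close> fails to avoid \<open>P\<close>, the
    offending value is a suffix, and what precedes it is a prefix of \<open>w\<close>, hence
    avoiding.\<close>
  have sub: "X \<subseteq> avoiding A P (Suc l) \<union> (\<Union>e\<in>P. \<Union>f\<in>F e. Y e f)"
  proof
    fix x assume "x \<in> X"
    then obtain w a where x: "x = w @ [a]" and w: "w \<in> avoiding A P l" and a: "a \<in> A"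
      unfolding X_def by auto
    have lw: "length w = l" and sw: "set (w @ [a]) \<subseteq> A" using w a by (auto simp: avoiding_def)
    show "x \<in> avoiding A P (Suc l) \<union> (\<Union>e\<in>P. \<Union>f\<in>F e. Y e f)"
    proof (cases "x \<in> avoiding A P (Suc l)")
      case False
      then obtain e where e: "e \<in> P" "encounters (w @ [a]) e"
        using x lw sw unfolding avoiding_def by auto
      have nw: "\<not> encounters w e" using w e(1) by (auto simp: avoiding_def)
      obtain f y where
        f: "f \<in> F e" and y: "w @ [a] = y @ subst f e" and ne: "subst f e \<noteq> []"
        unfolding F_def W_def lw[symmetric]
        by (rule new_occurrence_is_suffix[OF e(2) nw sw pat(1)[OF e(1)]])
      have len: "Suc l = length y + length (subst f e)"
        using arg_cong[OF y, of length] lw by simp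
      have "w = y @ butlast (subst f e)"
        using arg_cong[OF y, of butlast] ne by (simp add: butlast_append)
      then have "sublist y w" by (metis sublist_append_rightI)
      then have "y \<in> avoiding A P (length y)"
        using w set_mono_sublist[of y w] encounters_mono[of y _ w] unfolding avoiding_def by blast
      then have "x \<in> Y e f" unfolding Y_def x y using ne len by auto
      then show ?thesis using e(1) f by blast
    qed simp
  qed
  have "real (card X) \<le> real (card (avoiding A P (Suc l) \<union> (\<Union>e\<in>P. \<Union>f\<in>F e. Y e f)))"
    using sub P finF finY finav by (intro of_nat_mono card_mono) auto
  also have "\<dots> \<le> real (card (avoiding A P (Suc l)) + card (\<Union>e\<in>P. \<Union>f\<in>F e. Y e f))"
    by (intro of_nat_mono card_Un_le)
  also have "card (\<Union>e\<in>P. \<Union>f\<in>F e. Y e f) \<le> (\<Sum>e\<in>P. card (\<Union>f\<in>F e. Y e f))"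
    by (rule card_UN_le[OF P])
  also have "\<dots> \<le> (\<Sum>e\<in>P. \<Sum>f\<in>F e. card (Y e f))"
    by (intro sum_mono card_UN_le finF)
  finally have "m * g l \<le> g (Suc l) + (\<Sum>e\<in>P. \<Sum>f\<in>F e. real (card (Y e f)))"
    by (simp add: cardX g_def)
  also have "(\<Sum>e\<in>P. \<Sum>f\<in>F e. real (card (Y e f)))
      \<le> (\<Sum>e\<in>P. \<mu> * g l * (\<Sum>f\<in>F e. (1 / \<mu>) ^ length (subst f e)))"
    unfolding sum_distrib_left by (intro sum_mono cardY)
  \<comment> \<open>The choice of \<open>m\<close> gives 4 / (m - 4) = 1 / \<open>card P\<close>, so
    all patterns together destroy at most \<mu> * \<open>g l\<close> extensions.\<close>
  also have "\<dots> \<le> (\<Sum>e\<in>P. \<mu> * g l * (1 / card P))"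
  proof (intro sum_mono mult_left_mono)
    fix e assume e: "e \<in> P"
    have P0: "card P > 0" using e P card_gt_0_iff by blast
    show "(\<Sum>f\<in>F e. (1 / \<mu>) ^ length (subst f e)) \<le> 1 / card P"
      unfolding F_def
      by (rule weighted_substitutions_le[OF A _ pat(1)[OF e] pat(2)[OF e] \<mu> W_def])
        (use P0 m in \<open>auto simp: field_simps\<close>)
    show "0 \<le> \<mu> * g l" using lam by (simp add: g_def)
  qed
  also have "\<dots> \<le> \<mu> * g l"
    using lam by (cases "card P = 0") (auto simp: g_def)
  finally have "m * g l \<le> g (Suc l) + \<mu> * g l" by simp
  \<comment> \<open>Since m = 2 \<mu>, at least half of the extensions survive.\<close>
  moreover have "m * g l = \<mu> * g l + \<mu> * g l" unfolding \<mu> by simp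
  ultimately have "\<mu> * g l \<le> g (Suc l)" by simp
  then show ?case by (simp add: g_def)
qed

text \<open>The growth factor m / 2 is at least 2, and the empty word avoids every nonempty
  pattern.\<close>

lemma card_avoiding_ge:
  fixes A :: "'c set" and P :: "'b list set"
  assumes A: "finite A" "card A = m" and P: "finite P" and m: "m = 4 * card P + 4"
    and pat: "\<And>e. e \<in> P \<Longrightarrow> e \<noteq> []" "\<And>e x. e \<in> P \<Longrightarrow> x \<in> set e \<Longrightarrow> count_list e x \<ge> 2"
  shows "2 ^ l \<le> real (card (avoiding A P l))"
proof (induction l)
  case 0
  have "\<not> encounters [] e" if "e \<in> P" for e
    using pat(1)[OF that] unfolding encounters_def subst_def by (cases e) auto
  then have "avoiding A P 0 = {[]}" unfolding avoiding_def by auto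
  then show ?case by simp
next
  case (Suc l)
  have "2 ^ Suc l \<le> 2 * real (card (avoiding A P l))" using Suc by simp
  also have "\<dots> \<le> real m / 2 * card (avoiding A P l)"
    using m by (intro mult_right_mono) auto
  also have "\<dots> \<le> card (avoiding A P (Suc l))"
    by (rule card_avoiding_Suc[OF A P m pat refl])
  finally show ?case .
qed


section \<open>Evaluating words in triangular matrices\<close>

definition eval_word :: "nat \<Rightarrow> (nat \<Rightarrow> 'a::field mat) \<Rightarrow> nat list \<Rightarrow> 'a mat" where
  "eval_word n \<rho> w = foldr (\<lambda>a M. \<rho> a * M) w (1\<^sub>m n)"

lemma eval_word_simps [simp]:
  "eval_word n \<rho> [] = 1\<^sub>m n"
  "eval_word n \<rho> (a # w) = \<rho> a * eval_word n \<rho> w"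
  by (simp_all add: eval_word_def)

lemma eval_word_in_carrier:
  assumes "\<And>a. \<rho> a \<in> carrier (UpmT n)"
  shows "eval_word n \<rho> w \<in> carrier (UpmT n)"
proof -
  interpret monoid "UpmT n :: 'a mat monoid" by (rule monoid_UpmT)
  show ?thesis
  proof (induction w)
    case Nil
    show ?case using one_closed by (simp add: UpmT_def)
  next
    case (Cons a w)
    show ?case using m_closed[OF assms Cons] by (simp add: UpmT_def)
  qed
qed

lemma carrier_UpmT_carrier_mat: "M \<in> carrier (UpmT n) \<Longrightarrow> M \<in> carrier_mat n n"
  by (simp add: UpmT_def)

lemma eval_word_append:
  assumes "\<And>a. \<rho> a \<in> carrier (UpmT n)"
  shows "eval_word n \<rho> (u @ v) = eval_word n \<rho> u * eval_word n \<rho> v"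
proof (induction u)
  case Nil
  show ?case
    using left_mult_one_mat[OF carrier_UpmT_carrier_mat[OF eval_word_in_carrier[of \<rho>, OF assms]]]
    by simp
next
  case (Cons a u)
  note c = carrier_UpmT_carrier_mat[OF eval_word_in_carrier[of \<rho>, OF assms]]
    carrier_UpmT_carrier_mat[of "\<rho> a", OF assms]
  show ?case by (simp add: Cons assoc_mult_mat[OF c(2) c(1) c(1)])
qed

text \<open>A homomorphism on the free semigroup is determined by its values on letters, which are
  arbitrary. The empty word has the identity matrix as its value under \<open>eval_word\<close>, but
  lies outside the free semigroup.\<close>

lemma holds_in_UpmT_iff:
  fixes u v :: "nat list"
  assumes "u \<noteq> []" "v \<noteq> []"
  shows "holds_in (UpmT n :: 'a::field mat monoid) (u, v) \<longleftrightarrow>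
    (\<forall>\<rho> :: nat \<Rightarrow> 'a mat. (\<forall>a. \<rho> a \<in> carrier (UpmT n)) \<longrightarrow> eval_word n \<rho> u = eval_word n \<rho> v)"
proof
  assume h: "holds_in (UpmT n :: 'a mat monoid) (u, v)"
  show "\<forall>\<rho> :: nat \<Rightarrow> 'a mat. (\<forall>a. \<rho> a \<in> carrier (UpmT n)) \<longrightarrow> eval_word n \<rho> u = eval_word n \<rho> v"
  proof (intro allI impI)
    fix \<rho> :: "nat \<Rightarrow> 'a mat" assume \<rho>: "\<forall>a. \<rho> a \<in> carrier (UpmT n)"
    then have "eval_word n \<rho> \<in> hom free_semigroup (UpmT n)"
      using eval_word_in_carrier[of \<rho> n] eval_word_append[of \<rho> n]
      by (auto simp: hom_def free_semigroup_def) (simp add: UpmT_def)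
    then show "eval_word n \<rho> u = eval_word n \<rho> v"
      using h unfolding holds_in_def by auto
  qed
next
  assume h: "\<forall>\<rho> :: nat \<Rightarrow> 'a mat. (\<forall>a. \<rho> a \<in> carrier (UpmT n)) \<longrightarrow> eval_word n \<rho> u = eval_word n \<rho> v"
  show "holds_in (UpmT n :: 'a mat monoid) (u, v)"
    unfolding holds_in_def
  proof
    fix \<phi> :: "nat list \<Rightarrow> 'a mat" assume \<phi>: "\<phi> \<in> hom free_semigroup (UpmT n)"
    define \<rho> where "\<rho> a = \<phi> [a]" for a
    have \<rho>: "\<rho> a \<in> carrier (UpmT n)" for a
      using \<phi> by (auto simp: hom_def free_semigroup_def \<rho>_def)
    have "\<phi> w = eval_word n \<rho> w" if "w \<noteq> []" for w
      using that
    proof (induction w rule: list_nonempty_induct)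
      case (single a)
      show ?case using carrier_UpmT_carrier_mat[OF \<rho>[of a]] by (simp add: \<rho>_def)
    next
      case (cons a w)
      have "\<phi> ([a] @ w) = \<phi> [a] * \<phi> w"
        using \<phi> cons.hyps by (auto simp: hom_def free_semigroup_def UpmT_def simp del: append_Cons)
      then show ?case using cons by (simp add: \<rho>_def)
    qed
    then show "\<phi> (fst (u, v)) = \<phi> (snd (u, v))"
      using assms h \<rho> by simp
  qed
qed

lemma mult_mat_entry:
  assumes "A \<in> carrier_mat n n" "B \<in> carrier_mat n n" "i < n" "j < n"
  shows "(A * B) $$ (i, j) = (\<Sum>k<n. A $$ (i, k) * B $$ (k, j))"
  using assms by (auto simp: scalar_prod_def lessThan_atLeast0 intro!: sum.cong)

section \<open>Words without even factors are isoterms\<close>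

text \<open>Evenness of \<open>u @ v\<close> expresses that \<open>u\<close> and \<open>v\<close>
  have the same parity vector, that is, lead to the same element of the elementary abelian 2-group
  on the letters.\<close>

definition even_word :: "'c list \<Rightarrow> bool" where
  "even_word w \<longleftrightarrow> (\<forall>x. even (count_list w x))"

lemma even_word_commute: "even_word (u @ v) \<longleftrightarrow> even_word (v @ u)"
  by (simp add: even_word_def add.commute)

lemma even_word_self_append: "even_word (u @ u)"
  by (simp add: even_word_def)

lemma prod_list_map_eq_prod_count:
  fixes \<chi> :: "'c \<Rightarrow> 'd::comm_monoid_mult"
  assumes "finite A" "set w \<subseteq> A"
  shows "prod_list (map \<chi> w) = (\<Prod>x\<in>A. \<chi> x ^ count_list w x)"
  using assms(2)
proof (induction w)
  case (Cons a w)
  have "(\<Prod>x\<in>A. \<chi> x ^ count_list (a # w) x)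
      = (\<Prod>x\<in>A. (if x = a then \<chi> x else 1) * \<chi> x ^ count_list w x)"
    by (intro prod.cong) auto
  also have "\<dots> = \<chi> a * (\<Prod>x\<in>A. \<chi> x ^ count_list w x)"
    using Cons.prems assms(1) by (simp add: prod.distrib)
  finally show ?case using Cons by simp
qed simp

text \<open>Orthogonality of characters: the sum over all sign assignments factors over the
  letters.\<close>

lemma sum_sign_characters:
  assumes "finite A" "set w \<subseteq> A"
  shows "(\<Sum>\<chi>\<in>PiE A (\<lambda>_. {1, -1}). prod_list (map \<chi> w))
    = (if even_word w then 2 ^ card A else (0 :: 'a::field_char_0))"
proof -
  have "(\<Sum>\<chi>\<in>PiE A (\<lambda>_. {1, -1 :: 'a}). prod_list (map \<chi> w))
      = (\<Prod>x\<in>A. \<Sum>y\<in>{1, -1 :: 'a}. y ^ count_list w x)"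
    by (subst prod_sum_PiE) (auto simp: assms prod_list_map_eq_prod_count[OF assms])
  \<comment> \<open>In characteristic 0 the elements 1 and -1 are distinct, so each factor has
    exactly two summands.\<close>
  also have "\<dots> = (\<Prod>x\<in>A. if even (count_list w x) then 2 else 0)"
    by (intro prod.cong) (auto simp: uminus_power_if)
  also have "\<dots> = (if even_word w then 2 ^ card A else 0)"
  proof (cases "even_word w")
    case False
    then obtain x where x: "odd (count_list w x)" by (auto simp: even_word_def)
    then have "x \<in> A" using assms(2) by (metis count_notin even_zero subsetD)
    then show ?thesis using False x assms(1) by (auto simp: prod_zero_iff)
  qed (simp add: even_word_def)
  finally show ?thesis .
qed

text \<open>The upper left block has rows (\<chi>(y), [y = x]) and (0, 1); all other entries vanish.
  State 0 records the character of the prefix read so far, and the letter \<open>x\<close> permits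
  moving to state 1.\<close>

definition edge_mat :: "nat \<Rightarrow> (nat \<Rightarrow> 'a::field) \<Rightarrow> nat \<Rightarrow> nat \<Rightarrow> 'a mat" where
  "edge_mat n \<chi> x y = mat n n (\<lambda>(i, j).
     if i = 0 \<and> j = 0 then \<chi> y else if i = 1 \<and> j = 1 then 1
     else if i = 0 \<and> j = 1 \<and> y = x then 1 else 0)"

lemma edge_mat_index:
  "i < n \<Longrightarrow> j < n \<Longrightarrow> edge_mat n \<chi> x y $$ (i, j) =
    (if i = 0 \<and> j = 0 then \<chi> y else if i = 1 \<and> j = 1 then 1
     else if i = 0 \<and> j = 1 \<and> y = x then 1 else 0)"
  by (simp add: edge_mat_def)

lemma edge_mat_in_carrier: "\<chi> y \<in> {0, 1, -1} \<Longrightarrow> edge_mat n \<chi> x y \<in> carrier (UpmT n)"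
  by (auto simp: UpmT_def edge_mat_def upper_triangular_def)

text \<open>A contribution to entry (0, 1) stays in state 0 along a prefix, collecting its
  character, moves to state 1 at an occurrence of \<open>x\<close>, and stays there with weight
  1.\<close>

lemma eval_edge_mat:
  assumes n: "n \<ge> 2" and \<chi>: "\<And>y. \<chi> y \<in> {0, 1, -1 :: 'a::field}"
  shows "eval_word n (edge_mat n \<chi> x) w $$ (0, 1)
    = (\<Sum>p<length w. if w ! p = x then prod_list (map \<chi> (take p w)) else 0)"
proof -
  have "edge_mat n \<chi> x y \<in> carrier (UpmT n)" for y
    using \<chi> by (rule edge_mat_in_carrier)
  note c = carrier_UpmT_carrier_mat[OF this]
    carrier_UpmT_carrier_mat[OF eval_word_in_carrier[of "edge_mat n \<chi> x", OF this]]
  have two: "(\<Sum>k<n. f k) = f 0 + f 1" if "\<And>k. k \<ge> 2 \<Longrightarrow> f k = 0" for f :: "nat \<Rightarrow> 'a"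
  proof -
    have "(\<Sum>k<n. f k) = (\<Sum>k\<in>{0, 1}. f k)"
      using n that by (intro sum.mono_neutral_right) (auto simp: not_less_eq_eq numeral_2_eq_2)
    then show ?thesis by simp
  qed
  have step: "eval_word n (edge_mat n \<chi> x) (a # w) $$ (i, 1)
      = (edge_mat n \<chi> x a $$ (i, 0)) * eval_word n (edge_mat n \<chi> x) w $$ (0, 1)
        + (edge_mat n \<chi> x a $$ (i, 1)) * eval_word n (edge_mat n \<chi> x) w $$ (1, 1)"
    if "i < 2" for i a w
  proof -
    have "eval_word n (edge_mat n \<chi> x) (a # w) $$ (i, 1)
        = (\<Sum>k<n. edge_mat n \<chi> x a $$ (i, k) * eval_word n (edge_mat n \<chi> x) w $$ (k, 1))"
      unfolding eval_word_simps using n that by (intro mult_mat_entry c) auto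
    also have "\<dots> = (\<Sum>k<n. if k < 2 then edge_mat n \<chi> x a $$ (i, k)
        * eval_word n (edge_mat n \<chi> x) w $$ (k, 1) else 0)"
      using n that by (intro sum.cong) (auto simp: edge_mat_index)
    finally show ?thesis by (subst (asm) two) auto
  qed
  have diag: "eval_word n (edge_mat n \<chi> x) w $$ (1, 1) = 1" for w
  proof (induction w)
    case (Cons a w)
    then show ?case using n by (subst step) (auto simp: edge_mat_index)
  qed (use n in auto)
  show ?thesis
  proof (induction w)
    case (Cons a w)
    have "eval_word n (edge_mat n \<chi> x) (a # w) $$ (0, 1)
        = \<chi> a * eval_word n (edge_mat n \<chi> x) w $$ (0, 1) + (if a = x then 1 else 0)"
      using n by (subst step) (auto simp: edge_mat_index diag[simplified])
    also have "\<dots> = (\<Sum>p<length (a # w).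
        if (a # w) ! p = x then prod_list (map \<chi> (take p (a # w))) else 0)"
      by (simp add: Cons[unfolded One_nat_def] sum.lessThan_Suc_shift sum_distrib_left if_distrib add.commute
          del: sum.lessThan_Suc cong: if_cong)
    finally show ?case .
  qed (use n in auto)
qed

text \<open>
  A word describes a walk in the Cayley graph of the elementary abelian 2-group on the letters;
  the identities of \<open>UpmT 2\<close> determine the number of times each edge is traversed.
\<close>

lemma edge_count_eq:
  fixes u v z :: "nat list"
  assumes h: "holds_in (UpmT n :: 'a::field_char_0 mat monoid) (u, v)"
    and n: "n \<ge> 2" and ne: "u \<noteq> []" "v \<noteq> []"
  shows "card {p. p < length u \<and> u ! p = x \<and> even_word (take p u @ z)}
    = card {p. p < length v \<and> v ! p = x \<and> even_word (take p v @ z)}"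
proof -
  define A where "A = set u \<union> set v \<union> set z"
  have finA: "finite A" by (simp add: A_def)
  define s where "s w \<chi> = (\<Sum>p<length w. if w ! p = x then prod_list (map \<chi> (take p w)) else 0)"
    for w and \<chi> :: "nat \<Rightarrow> 'a"
  \<comment> \<open>Multiplying by the character value of \<open>z\<close> and averaging isolates
    the occurrences of \<open>x\<close> whose preceding prefix has the parity vector of
    \<open>z\<close>.\<close>
  have count: "(\<Sum>\<chi>\<in>PiE A (\<lambda>_. {1, -1}). s w \<chi> * prod_list (map \<chi> z))
      = 2 ^ card A * of_nat (card {p. p < length w \<and> w ! p = x \<and> even_word (take p w @ z)})"
    if w: "set w \<subseteq> A" for w
  proof -
    have "(\<Sum>\<chi>\<in>PiE A (\<lambda>_. {1, -1}). s w \<chi> * prod_list (map \<chi> z))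
        = (\<Sum>\<chi>\<in>PiE A (\<lambda>_. {1, -1}). \<Sum>p<length w.
             if w ! p = x then prod_list (map \<chi> (take p w @ z)) else 0)"
      unfolding s_def sum_distrib_right by (intro sum.cong) auto
    also have "\<dots> = (\<Sum>p<length w. \<Sum>\<chi>\<in>PiE A (\<lambda>_. {1, -1}).
             if w ! p = x then prod_list (map \<chi> (take p w @ z)) else 0)"
      by (rule sum.swap)
    also have "\<dots> = (\<Sum>p<length w. if w ! p = x \<and> even_word (take p w @ z) then 2 ^ card A else 0)"
    proof (rule sum.cong[OF refl])
      fix p
      have "set (take p w @ z) \<subseteq> A" using w set_take_subset[of p w] by (auto simp: A_def)
      from sum_sign_characters[OF finA this, where 'a = 'a]
      show "(\<Sum>\<chi>\<in>PiE A (\<lambda>_. {1, -1}). if w ! p = x then prod_list (map \<chi> (take p w @ z)) else 0)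
          = (if w ! p = x \<and> even_word (take p w @ z) then 2 ^ card A else (0::'a))"
        by (cases "w ! p = x") simp_all
    qed
    also have "\<dots> = (\<Sum>p\<in>{p. p < length w \<and> w ! p = x \<and> even_word (take p w @ z)}. 2 ^ card A)"
      by (rule sum.mono_neutral_cong_right) auto
    finally show ?thesis by (simp add: mult.commute)
  qed
  have "s u \<chi> = s v \<chi>" if \<chi>: "\<chi> \<in> PiE A (\<lambda>_. {1, -1})" for \<chi>
  proof -
    \<comment> \<open>Every variable needs an admissible matrix, so the character is extended by 1
      outside \<open>A\<close>.\<close>
    define \<chi>' where "\<chi>' y = (if y \<in> A then \<chi> y else 1)" for y
    have \<chi>': "\<chi>' y \<in> {0, 1, -1}" for y using \<chi> by (auto simp: \<chi>'_def)
    have eq: "s w \<chi> = s w \<chi>'" if "set w \<subseteq> A" for w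
      unfolding s_def using that
      by (intro sum.cong if_cong refl arg_cong[of _ _ prod_list] map_cong)
        (auto simp: \<chi>'_def dest: in_set_takeD)
    have "\<forall>y. edge_mat n \<chi>' x y \<in> carrier (UpmT n)"
      using \<chi>' by (intro allI edge_mat_in_carrier)
    then have "eval_word n (edge_mat n \<chi>' x) u = eval_word n (edge_mat n \<chi>' x) v"
      using h[unfolded holds_in_UpmT_iff[OF ne]] by blast
    then have "s u \<chi>' = s v \<chi>'"
      using eval_edge_mat[of n \<chi>' x u, OF n \<chi>'] eval_edge_mat[of n \<chi>' x v, OF n \<chi>']
      unfolding s_def by simp
    moreover have "set u \<subseteq> A" "set v \<subseteq> A" by (auto simp: A_def)
    ultimately show ?thesis using eq by simp
  qed
  then have "(\<Sum>\<chi>\<in>PiE A (\<lambda>_. {1, -1}). s u \<chi> * prod_list (map \<chi> z))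
      = (\<Sum>\<chi>\<in>PiE A (\<lambda>_. {1, -1}). s v \<chi> * prod_list (map \<chi> z))"
    by (intro sum.cong) auto
  \<comment> \<open>In characteristic 0 the factor 2^\<open>card A\<close> cancels and
    \<open>of_nat\<close> is injective.\<close>
  then show ?thesis
    by (subst (asm) (1 2) count) (auto simp: A_def)
qed

text \<open>The walk of \<open>u\<close> never revisits a vertex, so at most one edge leaves each
  vertex. Since \<open>v\<close> uses exactly the same edges, it has to follow \<open>u\<close>
  letter by letter and stop where \<open>u\<close> stops.\<close>

lemma isoterm_if_no_even_factor:
  fixes u v :: "nat list"
  assumes h: "holds_in (UpmT n :: 'a::field_char_0 mat monoid) (u, v)"
    and n: "n \<ge> 2" and ne: "u \<noteq> []" "v \<noteq> []"
    and no_even: "\<And>e. sublist e u \<Longrightarrow> even_word e \<Longrightarrow> e = []"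
  shows "u = v"
proof -
  have edge: "(\<exists>p<length u. u ! p = x \<and> even_word (take p u @ z))
      \<longleftrightarrow> (\<exists>p<length v. v ! p = x \<and> even_word (take p v @ z))" for x z
  proof -
    have "{p. p < length u \<and> u ! p = x \<and> even_word (take p u @ z)} = {} \<longleftrightarrow>
        {p. p < length v \<and> v ! p = x \<and> even_word (take p v @ z)} = {}"
      using edge_count_eq[OF h n ne, of x z] by (subst (1 2) card_0_eq[symmetric]) auto
    then show ?thesis by auto
  qed
  \<comment> \<open>Two prefixes with equal parity vectors would enclose a nonempty even
    factor.\<close>
  have lt: "\<not> even_word (take q u @ take p u)" if "q < p" "p \<le> length u" for p q
  proof
    assume ev: "even_word (take q u @ take p u)"
    define e where "e = drop q (take p u)"
    have tp: "take p u = take q u @ e"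
      using that by (metis append_take_drop_id e_def less_imp_le min.absorb1 take_take)
    have "sublist e u"
      using sublist_order.order_trans[OF sublist_drop sublist_take] unfolding e_def .
    moreover have "even_word e" using ev unfolding tp even_word_def by simp blast
    ultimately have "e = []" by (rule no_even)
    then show False using that by (simp add: e_def)
  qed
  have inj: "q = p" if "even_word (take q u @ take p u)" "q \<le> length u" "p \<le> length u" for p q
    using that lt[of p q] lt[of q p] even_word_commute by (metis linorder_neqE_nat)
  have pre: "p \<le> length u \<and> take p v = take p u" if "p \<le> length v" for p
    using that
  proof (induction p)
    case (Suc p)
    then have IH: "p \<le> length u" "take p v = take p u" and p: "p < length v" by auto
    \<comment> \<open>With \<open>z\<close> taken to be the common prefix of length
      \<open>p\<close>, the next edge of \<open>v\<close> also occurs in \<open>u\<close>, and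
      distinctness of vertices forces it to occur at position \<open>p\<close>.\<close>
    have "\<exists>q<length v. v ! q = v ! p \<and> even_word (take q v @ take p u)"
      using p IH even_word_self_append by metis
    then obtain q where q: "q < length u" "u ! q = v ! p" "even_word (take q u @ take p u)"
      unfolding edge[symmetric] by blast
    then have "q = p" using inj IH by simp
    then show ?case using q IH p by (simp add: take_Suc_conv_app_nth)
  qed simp
  have v: "v = take (length v) u" and le: "length v \<le> length u" using pre[of "length v"] by auto
  \<comment> \<open>Otherwise the edge of \<open>u\<close> leaving the endpoint of \<open>v\<close>
    would be traversed by \<open>v\<close> at an earlier position, giving a repeated vertex.\<close>
  have "\<not> length v < length u"
  proof
    assume lt': "length v < length u"
    have "\<exists>q<length u. u ! q = u ! length v \<and> even_word (take q u @ take (length v) u)"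
      using lt' even_word_self_append by metis
    then obtain q where q: "q < length v" "even_word (take q v @ take (length v) u)"
      unfolding edge by blast
    then have "even_word (take q u @ take (length v) u)" using pre[of q] by simp
    then show False using lt q(1) le by blast
  qed
  then show ?thesis using v le by simp
qed

section \<open>The number of word functions grows polynomially\<close>

text \<open>A path is a list of jumps (letter, target state). The coefficient sums over all
  placements of the jump letters as a subsequence of \<open>w\<close> the product of the diagonal
  entries, recorded as integers in \<delta>, at the remaining letters; \<open>i\<close> is the
  current state.\<close>

fun coef :: "(nat \<times> nat \<Rightarrow> int) \<Rightarrow> nat list \<Rightarrow> nat \<Rightarrow> (nat \<times> nat) list \<Rightarrow> int" where
  "coef \<delta> [] i p = (if p = [] then 1 else 0)"
| "coef \<delta> (a # w) i [] = \<delta> (a, i) * coef \<delta> w i []"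
| "coef \<delta> (a # w) i ((b, k) # p) =
     \<delta> (a, i) * coef \<delta> w i ((b, k) # p) + (if a = b then coef \<delta> w k p else 0)"

fun path_weight :: "(nat \<Rightarrow> 'a::field mat) \<Rightarrow> nat \<Rightarrow> nat \<Rightarrow> (nat \<times> nat) list \<Rightarrow> 'a" where
  "path_weight \<rho> j i [] = (if i = j then 1 else 0)"
| "path_weight \<rho> j i ((b, k) # p) = (if i < k then \<rho> b $$ (i, k) else 0) * path_weight \<rho> j k p"

definition paths :: "nat set \<Rightarrow> nat \<Rightarrow> nat \<Rightarrow> (nat \<times> nat) list set" where
  "paths A n d = {p. set p \<subseteq> A \<times> {..<n} \<and> length p \<le> d}"

lemma finite_paths: "finite A \<Longrightarrow> finite (paths A n d)"
  unfolding paths_def by (intro finite_lists_length_le) auto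

lemma paths_Suc:
  "paths A n (Suc d) = insert [] ((\<lambda>((b, k), p). (b, k) # p) ` ((A \<times> {..<n}) \<times> paths A n d))"
proof -
  have "p \<in> paths A n (Suc d) \<longleftrightarrow>
      p \<in> insert [] ((\<lambda>((b, k), p). (b, k) # p) ` ((A \<times> {..<n}) \<times> paths A n d))" for p
    by (cases p) (auto simp: paths_def image_iff)
  then show ?thesis by blast
qed

lemma sum_paths_Suc:
  fixes h :: "(nat \<times> nat) list \<Rightarrow> 'd::comm_monoid_add"
  assumes "finite A"
  shows "(\<Sum>p\<in>paths A n (Suc d). h p)
    = h [] + (\<Sum>k<n. \<Sum>b\<in>A. \<Sum>p\<in>paths A n d. h ((b, k) # p))"
proof -
  have "(\<Sum>p\<in>paths A n (Suc d). h p)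
      = h [] + (\<Sum>p\<in>(\<lambda>((b, k), p). (b, k) # p) ` ((A \<times> {..<n}) \<times> paths A n d). h p)"
    unfolding paths_Suc using assms finite_paths by (subst sum.insert) auto
  also have "(\<Sum>p\<in>(\<lambda>((b, k), p). (b, k) # p) ` ((A \<times> {..<n}) \<times> paths A n d). h p)
      = (\<Sum>((b, k), p)\<in>(A \<times> {..<n}) \<times> paths A n d. h ((b, k) # p))"
    by (subst sum.reindex) (auto simp: inj_on_def case_prod_unfold)
  also have "\<dots> = (\<Sum>s\<in>A \<times> {..<n}. \<Sum>p\<in>paths A n d. h (s # p))"
    by (simp add: sum.cartesian_product case_prod_unfold)
  also have "\<dots> = (\<Sum>b\<in>A. \<Sum>k<n. \<Sum>p\<in>paths A n d. h ((b, k) # p))"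
    by (subst sum.cartesian_product) (simp add: case_prod_unfold)
  also have "\<dots> = (\<Sum>k<n. \<Sum>b\<in>A. \<Sum>p\<in>paths A n d. h ((b, k) # p))"
    by (rule sum.swap)
  finally show ?thesis .
qed

text \<open>Only nondecreasing index sequences contribute to a product of triangular matrices, and
  they are grouped by their strict jumps. Apart from the diagonal, the matrices enter only through
  \<open>path_weight\<close>, which does not depend on \<open>w\<close>. From state \<open>i\<close>
  at most n - 1 - i jumps are possible, whence the condition on \<open>d\<close>.\<close>

lemma eval_word_expansion:
  fixes \<rho> :: "nat \<Rightarrow> 'a::field mat"
  assumes A: "finite A" and \<rho>: "\<And>a. \<rho> a \<in> carrier (UpmT n)"
    and \<delta>: "\<And>a k. a \<in> A \<Longrightarrow> k < n \<Longrightarrow> of_int (\<delta> (a, k)) = \<rho> a $$ (k, k)"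
    and "set w \<subseteq> A" "i < n" "j < n" "n \<le> Suc (i + d)"
  shows "eval_word n \<rho> w $$ (i, j)
    = (\<Sum>p\<in>paths A n d. of_int (coef \<delta> w i p) * path_weight \<rho> j i p)"
  using assms(4-7)
proof (induction w arbitrary: i d)
  case Nil
  have "(\<Sum>p\<in>paths A n d. of_int (coef \<delta> [] i p) * path_weight \<rho> j i p)
      = (\<Sum>p\<in>paths A n d. if p = [] then path_weight \<rho> j i [] else 0)"
    by (intro sum.cong) auto
  then show ?case using Nil finite_paths[OF A] by (simp add: paths_def)
next
  case (Cons a w)
  let ?M = "eval_word n \<rho> w"
  have a: "a \<in> A" and w: "set w \<subseteq> A" using Cons.prems by auto
  \<comment> \<open>\<open>h\<close> is the part of the expansion in which the first letter
    \<open>a\<close> performs the first jump.\<close>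
  define h where "h p = (case p of [] \<Rightarrow> 0
      | (b, k) # q \<Rightarrow> if a = b then of_int (coef \<delta> w k q) * path_weight \<rho> j i p else 0)" for p
  have ut: "\<rho> a $$ (i, k) = 0" if "k < i" for k
    using \<rho>[of a] that Cons.prems by (auto simp: UpmT_def upper_triangular_def)
  have tail: "(\<Sum>p\<in>paths A n d. h p) = (\<Sum>k<n. if i < k then \<rho> a $$ (i, k) * ?M $$ (k, j) else 0)"
  proof (cases d)
    case 0
    then have "paths A n d = {[]}" by (auto simp: paths_def)
    then have "(\<Sum>p\<in>paths A n d. h p) = 0" by (simp add: h_def)
    also have "\<dots> = (\<Sum>k<n. if i < k then \<rho> a $$ (i, k) * ?M $$ (k, j) else 0)"
      using Cons.prems 0 by (intro sum.neutral[symmetric]) auto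
    \<comment> \<open>For d = 0 the state \<open>i\<close> is n - 1, so no higher state is
      left.\<close>
    finally show ?thesis .
  next
    case (Suc d')
    have "(\<Sum>p\<in>paths A n d. h p) = (\<Sum>k<n. \<Sum>b\<in>A. \<Sum>p\<in>paths A n d'. h ((b, k) # p))"
      unfolding Suc sum_paths_Suc[OF A] by (simp add: h_def)
    also have "\<dots> = (\<Sum>k<n. if i < k then \<rho> a $$ (i, k) * ?M $$ (k, j) else 0)"
    proof (rule sum.cong[OF refl])
      fix k assume k: "k \<in> {..<n}"
      have "(\<Sum>b\<in>A. \<Sum>p\<in>paths A n d'. h ((b, k) # p))
          = (\<Sum>b\<in>A. if b = a then \<Sum>p\<in>paths A n d'. h ((a, k) # p) else 0)"
        by (intro sum.cong) (auto simp: h_def)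
      also have "\<dots> = (\<Sum>p\<in>paths A n d'. h ((a, k) # p))" using a A by simp
      also have "\<dots> = (if i < k then \<rho> a $$ (i, k) else 0) *
          (\<Sum>p\<in>paths A n d'. of_int (coef \<delta> w k p) * path_weight \<rho> j k p)"
        unfolding sum_distrib_left by (intro sum.cong) (auto simp: h_def)
      \<comment> \<open>A jump raises the state by at least 1, so the smaller budget
        \<open>d'\<close> suffices from \<open>k\<close>.\<close>
      also have "\<dots> = (if i < k then \<rho> a $$ (i, k) * ?M $$ (k, j) else 0)"
        using Cons.IH[OF w, of k d'] Cons.prems k Suc by auto
      finally show "(\<Sum>b\<in>A. \<Sum>p\<in>paths A n d'. h ((b, k) # p))
          = (if i < k then \<rho> a $$ (i, k) * ?M $$ (k, j) else 0)" .
    qed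
    finally show ?thesis .
  qed
  have "eval_word n \<rho> (a # w) $$ (i, j) = (\<Sum>k<n. \<rho> a $$ (i, k) * ?M $$ (k, j))"
    unfolding eval_word_simps using Cons.prems
    by (intro mult_mat_entry carrier_UpmT_carrier_mat \<rho> eval_word_in_carrier)
  also have "\<dots> = (\<Sum>k<n. (if k = i then \<rho> a $$ (i, i) * ?M $$ (i, j) else 0)
      + (if i < k then \<rho> a $$ (i, k) * ?M $$ (k, j) else 0))"
    by (intro sum.cong) (auto simp: ut not_less less_le)
  also have "\<dots> = \<rho> a $$ (i, i) * ?M $$ (i, j) + (\<Sum>p\<in>paths A n d. h p)"
    using Cons.prems by (simp add: sum.distrib tail)
  also have "\<dots> = (\<Sum>p\<in>paths A n d. of_int (\<delta> (a, i)) * (of_int (coef \<delta> w i p) * path_weight \<rho> j i p) + h p)"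
    using Cons.IH[OF w, of i d] Cons.prems \<delta>[OF a, of i] by (simp add: sum.distrib sum_distrib_left)
  also have "\<dots> = (\<Sum>p\<in>paths A n d. of_int (coef \<delta> (a # w) i p) * path_weight \<rho> j i p)"
  proof (rule sum.cong[OF refl])
    fix p
    show "of_int (\<delta> (a, i)) * (of_int (coef \<delta> w i p) * path_weight \<rho> j i p) + h p
        = of_int (coef \<delta> (a # w) i p) * path_weight \<rho> j i p"
      by (cases p) (auto simp: h_def algebra_simps split: prod.splits)
  qed
  finally show ?case .
qed

text \<open>The coefficient is a sum of terms 0, 1 or -1, one for each placement of the jumps in
  \<open>w\<close>, so it grows at most polynomially in the length of \<open>w\<close>.\<close>

lemma abs_coef_le:
  assumes "\<And>s. \<bar>\<delta> s\<bar> \<le> 1"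
  shows "\<bar>coef \<delta> w i p\<bar> \<le> (int (length w) + 1) ^ length p"
  using assms
proof (induction \<delta> w i p rule: coef.induct)
  case (2 \<delta> a w i)
  then have "\<bar>\<delta> (a, i)\<bar> * \<bar>coef \<delta> w i []\<bar> \<le> 1 * 1" by (intro mult_mono) auto
  then show ?case by (simp add: abs_mult)
next
  case (3 \<delta> a w i b k p)
  define L where "L = int (length w) + 1"
  have "\<bar>coef \<delta> (a # w) i ((b, k) # p)\<bar>
      \<le> \<bar>\<delta> (a, i)\<bar> * \<bar>coef \<delta> w i ((b, k) # p)\<bar> + \<bar>if a = b then coef \<delta> w k p else 0\<bar>"
    using abs_triangle_ineq by (simp add: abs_mult[symmetric])
  also have "\<dots> \<le> 1 * L ^ Suc (length p) + L ^ length p"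
    using 3 by (intro add_mono mult_mono) (auto simp: L_def)
  also have "\<dots> = (L + 1) * L ^ length p" by (simp add: algebra_simps)
  also have "\<dots> \<le> (L + 1) * (L + 1) ^ length p"
    by (intro mult_left_mono power_mono) (auto simp: L_def)
  finally show ?case by (simp add: L_def algebra_simps)
qed auto

section \<open>Pigeonhole argument on coefficient vectors\<close>

lemma exists_poly_less_exp:
  fixes n N :: nat
  shows "\<exists>l. (2 * (l + 1) ^ n + 1) ^ N < (2::nat) ^ l"
proof -
  \<comment> \<open>The witness is 2^t - 1, so that l + 1 is a power of 2 and only exponents need
    comparing. \<open>C\<close> absorbs the exponent (t * n + 2) * N + 1 into t * C, and t = 4 * C
    makes t * C = (2 * C)^2 smaller than 2^t.\<close>
  define C where "C = (n + 2) * N + 1"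
  define t where "t = 4 * C"
  have C: "C \<ge> 1" by (simp add: C_def)
  have "2 * C \<le> 2 ^ C"
    using C by (induction C rule: dec_induct) auto
  then have "(2 * C) * (2 * C) \<le> 2 ^ C * 2 ^ C" by (intro mult_le_mono)
  also have "\<dots> = 2 ^ (C + C)" by (simp add: power_add)
  also have "\<dots> < 2 ^ t" using C by (simp add: t_def)
  finally have tC: "t * C < 2 ^ t" by (simp add: t_def algebra_simps)
  have "2 * (2 ^ t) ^ n + 1 \<le> (2::nat) ^ (t * n + 2)"
    by (simp add: power_mult[symmetric] power_add)
  then have "(2 * (2 ^ t) ^ n + 1) ^ N \<le> ((2::nat) ^ (t * n + 2)) ^ N"
    by (rule power_mono) simp
  also have "\<dots> = 2 ^ ((t * n + 2) * N)" by (simp only: power_mult)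
  also have "\<dots> < 2 ^ (2 ^ t - 1)"
  proof (rule power_strict_increasing)
    have "(t * n + 2) * N + 1 \<le> (t * n + t * 2) * N + t"
      using C by (intro add_mono mult_le_mono) (auto simp: t_def)
    also have "\<dots> = t * C" by (simp add: C_def algebra_simps)
    also have "\<dots> \<le> 2 ^ t - 1" using tC by simp
    finally show "(t * n + 2) * N < 2 ^ t - 1" by simp
  qed simp
  finally show ?thesis by (intro exI[of _ "2 ^ t - 1"]) simp
qed

text \<open>Words with the same coefficients for all diagonals, start states and paths have equal
  values under every assignment. There are polynomially many such coefficient vectors in
  \<open>l\<close>, fewer than 2^l for a suitable \<open>l\<close>.\<close>

lemma collision_if_many_words:
  assumes A: "finite A"
  obtains l where "\<And>G. G \<subseteq> {w. length w = l \<and> set w \<subseteq> A} \<Longrightarrow> card G \<ge> 2 ^ l \<Longrightarrow>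
    \<exists>u\<in>G. \<exists>v\<in>G. u \<noteq> v \<and> u \<noteq> [] \<and> v \<noteq> [] \<and> holds_in (UpmT n :: 'a::field mat monoid) (u, v)"
proof -
  \<comment> \<open>All possible diagonals over \<open>A\<close>; setting \<delta> to 0 elsewhere
    makes this set finite even though \<open>nat\<close> is not.\<close>
  define D where "D = {\<delta> :: nat \<times> nat \<Rightarrow> int. \<forall>s. (s \<in> A \<times> {..<n} \<longrightarrow> \<delta> s \<in> {0, 1, -1})
    \<and> (s \<notin> A \<times> {..<n} \<longrightarrow> \<delta> s = 0)}"
  define K where "K = D \<times> {..<n} \<times> paths A n n"
  have "finite D" unfolding D_def using A by (intro finite_set_of_finite_funs) auto
  then have finK: "finite K" unfolding K_def using finite_paths[OF A] by auto
  obtain l where l: "(2 * (l + 1) ^ n + 1) ^ card K < (2::nat) ^ l"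
    using exists_poly_less_exp by blast
  show ?thesis
  proof (rule that[of l])
    fix G assume G: "G \<subseteq> {w. length w = l \<and> set w \<subseteq> A}" and cG: "card G \<ge> 2 ^ l"
    define B where "B = (int l + 1) ^ n"
    define stat where "stat w = restrict (\<lambda>(\<delta>, i, p). coef \<delta> w i p) K" for w
    define R where "R = PiE K (\<lambda>_. {- B..B})"
    have D1: "\<bar>\<delta> s\<bar> \<le> 1" if "\<delta> \<in> D" for \<delta> s
    proof -
      have "(s \<in> A \<times> {..<n} \<longrightarrow> \<delta> s \<in> {0, 1, -1}) \<and> (s \<notin> A \<times> {..<n} \<longrightarrow> \<delta> s = 0)"
        using that unfolding D_def by blast
      then show ?thesis by (cases "s \<in> A \<times> {..<n}") auto
    qed
    have "stat w \<in> R" if w: "w \<in> G" for w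
      unfolding stat_def R_def
    proof (rule restrict_PiE_iff[THEN iffD2], rule ballI)
      fix x assume "x \<in> K"
      then obtain \<delta> i p where x: "x = (\<delta>, i, p)" "\<delta> \<in> D" "length p \<le> n"
        by (auto simp: K_def paths_def)
      have "\<bar>coef \<delta> w i p\<bar> \<le> (int (length w) + 1) ^ length p"
        by (rule abs_coef_le) (rule D1[OF x(2)])
      also have "\<dots> \<le> B"
        using w G x(3) unfolding B_def by (auto intro!: power_increasing)
      finally show "(case x of (\<delta>, i, p) \<Rightarrow> coef \<delta> w i p) \<in> {- B..B}"
        using x(1) by auto
    qed
    then have sub: "stat ` G \<subseteq> R" by blast
    have finR: "finite R" unfolding R_def using finK by (intro finite_PiE) auto
    have "card (stat ` G) \<le> card R" using sub finR by (rule card_mono[rotated])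
    also have "\<dots> = nat (2 * B + 1) ^ card K"
      unfolding R_def by (subst card_PiE[OF finK]) (simp add: algebra_simps)
    also have "nat (2 * B + 1) = 2 * (l + 1) ^ n + 1"
      unfolding B_def by (simp add: nat_add_distrib nat_mult_distrib nat_power_eq)
    also note l
    also note cG
    finally have "\<not> inj_on stat G" by (rule pigeonhole)
    then obtain u v where uv: "u \<in> G" "v \<in> G" "u \<noteq> v" "stat u = stat v"
      by (auto simp: inj_on_def)
    have len: "length u = length v" and sets: "set u \<subseteq> A" "set v \<subseteq> A" using uv G by auto
    then have ne: "u \<noteq> []" "v \<noteq> []" using uv(3) by auto
    have "holds_in (UpmT n :: 'a mat monoid) (u, v)"
      unfolding holds_in_UpmT_iff[OF ne]
    proof (intro allI impI)
      fix \<rho> :: "nat \<Rightarrow> 'a mat" assume \<rho>: "\<forall>a. \<rho> a \<in> carrier (UpmT n)"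
      \<comment> \<open>A diagonal entry other than 0 and 1 must be -1 by membership in the
        monoid.\<close>
      define \<delta> where "\<delta> = (\<lambda>(a, k). if a \<in> A \<and> k < n then
        if \<rho> a $$ (k, k) = 0 then 0 else if \<rho> a $$ (k, k) = 1 then 1 else - 1 :: int else 0)"
      have \<delta>: "\<delta> \<in> D" by (auto simp: D_def \<delta>_def)
      have \<delta>\<rho>: "of_int (\<delta> (a, k)) = \<rho> a $$ (k, k)" if "a \<in> A" "k < n" for a k
        using that \<rho>[rule_format, of a] by (auto simp: \<delta>_def UpmT_def)
      have c: "eval_word n \<rho> w \<in> carrier_mat n n" for w
        by (rule carrier_UpmT_carrier_mat[OF eval_word_in_carrier]) (use \<rho> in blast)
      show "eval_word n \<rho> u = eval_word n \<rho> v"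
      proof (rule eq_matI)
        fix i j assume "i < dim_row (eval_word n \<rho> v)" "j < dim_col (eval_word n \<rho> v)"
        then have ij: "i < n" "j < n" using c[of v] by auto
        have "coef \<delta> u i p = coef \<delta> v i p" if "p \<in> paths A n n" for p
          using fun_cong[OF uv(4), of "(\<delta>, i, p)"] \<delta> ij that by (simp add: stat_def K_def)
        moreover have "eval_word n \<rho> w $$ (i, j)
            = (\<Sum>p\<in>paths A n n. of_int (coef \<delta> w i p) * path_weight \<rho> j i p)" if "set w \<subseteq> A" for w
          using \<rho> \<delta>\<rho> that ij by (intro eval_word_expansion[OF A]) auto
        ultimately show "eval_word n \<rho> u $$ (i, j) = eval_word n \<rho> v $$ (i, j)"
          using sets by simp
      qed (use c[of u] c[of v] in auto)
    qed
    then show "\<exists>u\<in>G. \<exists>v\<in>G. u \<noteq> v \<and> u \<noteq> [] \<and> v \<noteq> [] \<and>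
        holds_in (UpmT n :: 'a mat monoid) (u, v)"
      using uv ne by blast
  qed
qed

section \<open>The semigroup of factors of a word\<close>

text \<open>The empty word encodes the zero element.\<close>

definition factor_semigroup :: "nat list \<Rightarrow> nat list monoid" where
  "factor_semigroup u = \<lparr>carrier = {w. sublist w u},
     monoid.mult = (\<lambda>x y. if x = [] \<or> y = [] \<or> \<not> sublist (x @ y) u then [] else x @ y), one = []\<rparr>"

lemma sublist_appendD1: "sublist (x @ y) u \<Longrightarrow> sublist x u"
  and sublist_appendD2: "sublist (x @ y) u \<Longrightarrow> sublist y u"
  by (meson sublist_append_rightI sublist_append_leftI sublist_order.order_trans)+

text \<open>This is the Rees quotient of the free semigroup by the ideal of words that are not
  factors of \<open>u\<close>. Factors being closed under taking factors, both bracketings give the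
  concatenation or zero.\<close>

lemma is_semigroup_factor_semigroup: "is_semigroup (factor_semigroup u)"
proof -
  define m where "m x y = (if x = [] \<or> y = [] \<or> \<not> sublist (x @ y) u then [] else x @ y)" for x y
  have "m (m x y) z = (if x = [] \<or> y = [] \<or> z = [] \<or> \<not> sublist (x @ y @ z) u then [] else x @ y @ z)"
    for x y z
    using sublist_appendD1[of "x @ y" z u] unfolding m_def by simp
  moreover have "m x (m y z) = (if x = [] \<or> y = [] \<or> z = [] \<or> \<not> sublist (x @ y @ z) u then [] else x @ y @ z)"
    for x y z
    using sublist_appendD2[of x "y @ z" u] unfolding m_def by simp
  moreover have "sublist (m x y) u" for x y
    unfolding m_def by simp
  ultimately show ?thesis
    by (simp add: is_semigroup_def factor_semigroup_def flip: m_def)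
qed

text \<open>Zero is absorbing, so a nonzero value arises by pure concatenation of nonzero letter
  values.\<close>

lemma hom_factor_semigroup_nonzero:
  assumes \<phi>: "\<phi> \<in> hom free_semigroup (factor_semigroup u)" and "w \<noteq> []" "\<phi> w \<noteq> []"
  shows "\<phi> w = subst (\<lambda>a. \<phi> [a]) w \<and> (\<forall>a\<in>set w. \<phi> [a] \<noteq> [])"
  using assms(2,3)
proof (induction w rule: list_nonempty_induct)
  case (cons a w)
  have "\<phi> ([a] @ w) = (if \<phi> [a] = [] \<or> \<phi> w = [] \<or> \<not> sublist (\<phi> [a] @ \<phi> w) u then [] else \<phi> [a] @ \<phi> w)"
    using \<phi> cons.hyps
    by (auto simp: hom_def free_semigroup_def factor_semigroup_def simp del: append_Cons)
  then show ?case using cons by (auto simp: subst_def split: if_splits)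
qed (simp add: subst_def)

text \<open>The quotient map fixes \<open>u\<close>, while it sends \<open>v\<close> to itself or to
  zero.\<close>

lemma identity_fails_in_factor_semigroup:
  assumes "u \<noteq> v" "u \<noteq> []" "v \<noteq> []"
  shows "\<not> holds_in (factor_semigroup u) (u, v)"
proof
  assume h: "holds_in (factor_semigroup u) (u, v)"
  define \<phi> where "\<phi> w = (if sublist w u then w else [])" for w
  have "\<phi> \<in> hom free_semigroup (factor_semigroup u)"
    by (auto simp: hom_def free_semigroup_def factor_semigroup_def \<phi>_def
        dest: sublist_appendD1 sublist_appendD2)
  then have "\<phi> u = \<phi> v" using h by (auto simp: holds_in_def)
  then show False using assms by (auto simp: \<phi>_def split: if_splits)
qed

lemma sublist_subst: "sublist e w \<Longrightarrow> sublist (subst f e) (subst f w)"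
  unfolding sublist_def subst_def by (metis concat_append map_append)

text \<open>A nonzero value of \<open>w\<close> is a factor of \<open>u\<close> obtained by a
  nonerasing substitution, which also applies to every factor \<open>e\<close> of
  \<open>w\<close>.\<close>

lemma encounters_of_nonzero:
  assumes \<phi>: "\<phi> \<in> hom free_semigroup (factor_semigroup u)" and w: "w \<noteq> []" "\<phi> w \<noteq> []"
    and e: "sublist e w"
  shows "encounters u e"
proof -
  define f where "f a = \<phi> [a]" for a
  have f: "\<phi> w = subst f w" "\<forall>a\<in>set w. f a \<noteq> []"
    using hom_factor_semigroup_nonzero[OF \<phi> w] unfolding f_def by auto
  have "sublist (\<phi> w) u"
    using \<phi> w(1) by (auto simp: hom_def free_semigroup_def factor_semigroup_def)
  then have "sublist (subst f e) u"
    using sublist_subst[OF e, of f] f(1) sublist_order.order_trans by metis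
  then show ?thesis
    using f(2) set_mono_sublist[OF e] unfolding encounters_def by blast
qed

section \<open>Refutation of a finite identity basis\<close>

theorem theorem2p10:
  fixes n :: nat
  assumes "n \<ge> 2"
  shows "nonfinitely_based (UpmT n :: 'a::field_char_0 mat monoid)"
proof
  let ?S = "UpmT n :: 'a mat monoid"
  assume "finitely_based ?S"
  then obtain \<Sigma> where fin: "finite \<Sigma>" and sub: "\<Sigma> \<subseteq> semigroup_identities"
    and hold: "\<And>p. p \<in> \<Sigma> \<Longrightarrow> holds_in ?S p"
    and base: "\<And>e. e \<in> semigroup_identities \<Longrightarrow> holds_in ?S e \<Longrightarrow> consequence \<Sigma> e"
    unfolding finitely_based_def by auto
  define P where "P = {e \<in> (\<Union>p\<in>\<Sigma>. set (sublists (fst p)) \<union> set (sublists (snd p))).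
    e \<noteq> [] \<and> even_word e}"
  have finP: "finite P"
    unfolding P_def
    by (rule finite_subset[of _ "\<Union>p\<in>\<Sigma>. set (sublists (fst p)) \<union> set (sublists (snd p))"])
      (use fin in auto)
  have count: "count_list e x \<ge> 2" if "e \<in> P" "x \<in> set e" for e x
  proof -
    have "count_list e x \<noteq> 0" using that(2) by (simp add: count_list_0_iff)
    moreover have "even (count_list e x)" using that(1) by (simp add: P_def even_word_def)
    ultimately show ?thesis by (auto elim!: evenE)
  qed
  \<comment> \<open>The alphabet size is the one required by
    \<open>card_avoiding_ge\<close>.\<close>
  define A where "A = {..<4 * card P + 4}"
  have A: "finite A" "card A = 4 * card P + 4" by (simp_all add: A_def)
  from collision_if_many_words[OF A(1), of n, where 'a = 'a] obtain l where
    l: "\<And>G. G \<subseteq> {w. length w = l \<and> set w \<subseteq> A} \<Longrightarrow> card G \<ge> 2 ^ l \<Longrightarrow>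
      \<exists>u\<in>G. \<exists>v\<in>G. u \<noteq> v \<and> u \<noteq> [] \<and> v \<noteq> [] \<and> holds_in ?S (u, v)" by blast
  have "2 ^ l \<le> real (card (avoiding A P l))"
    by (rule card_avoiding_ge[OF A finP refl]) (use count in \<open>auto simp: P_def\<close>)
  then have many: "2 ^ l \<le> card (avoiding A P l)"
    by (metis of_nat_le_iff of_nat_numeral of_nat_power)
  have "avoiding A P l \<subseteq> {w. length w = l \<and> set w \<subseteq> A}" by (auto simp: avoiding_def)
  from l[OF this many] obtain u v where
    u: "u \<in> avoiding A P l" and uv: "u \<noteq> v" "u \<noteq> []" "v \<noteq> []" "holds_in ?S (u, v)"
    by blast
  let ?T = "factor_semigroup u"
  \<comment> \<open>Both sides of a nontrivial identity of \<Sigma> contain a pattern from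
    \<open>P\<close>, which \<open>u\<close> avoids, so both are sent to zero. The hypothesis is
    symmetric in \<open>s\<close> and \<open>t\<close> so that it covers either side.\<close>
  have zero: "\<phi> s = []" if p: "(s, t) \<in> \<Sigma> \<or> (t, s) \<in> \<Sigma>" and st: "s \<noteq> t"
    and \<phi>: "\<phi> \<in> hom free_semigroup ?T" for s t \<phi>
  proof (rule ccontr)
    assume nz: "\<phi> s \<noteq> []"
    have ne: "s \<noteq> []" "t \<noteq> []"
      using p sub by (auto simp: semigroup_identities_def free_semigroup_def)
    have "holds_in ?S (s, t)" using p hold by (fastforce simp: holds_in_def)
    then obtain e where e: "sublist e s" "even_word e" "e \<noteq> []"
      using isoterm_if_no_even_factor[OF _ assms ne] st by blast
    have "\<exists>p\<in>\<Sigma>. sublist e (fst p) \<or> sublist e (snd p)"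
      using p e(1) by (metis fst_conv snd_conv)
    then have "e \<in> P" using e(2,3) unfolding P_def by auto
    moreover have "encounters u e" by (rule encounters_of_nonzero[OF \<phi> ne(1) nz e(1)])
    ultimately show False using u by (auto simp: avoiding_def)
  qed
  have "holds_in ?T p" if p: "p \<in> \<Sigma>" for p
  proof (cases "fst p = snd p")
    case False
    obtain s t where st: "p = (s, t)" by (cases p)
    show ?thesis
      unfolding holds_in_def
    proof
      fix \<phi> assume "\<phi> \<in> hom free_semigroup ?T"
      with zero[of s t \<phi>] zero[of t s \<phi>] p False
      show "\<phi> (fst p) = \<phi> (snd p)" by (simp add: st)
    qed
  qed (simp add: holds_in_def)
  moreover have "(u, v) \<in> semigroup_identities"
    using uv by (simp add: semigroup_identities_def free_semigroup_def)
  \<comment> \<open>The factor semigroup is a model of \<Sigma> on lists, so the consequence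
    relation has to be transferred from semigroups on \<open>nat\<close>.\<close>
  ultimately have "holds_in ?T (u, v)"
    using consequence_holds_in[OF is_semigroup_factor_semigroup sub] base uv(4) by blast
  then show False using identity_fails_in_factor_semigroup uv by blast
qed

end
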